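(* Let $u,v\in\ell^+$ and let $B=(b_{n,k})_{n\ge1,k\ge1}$ be an infinite matrix with real entries. Consider the inequality \[ ( * )\qquad \|Bx\|_{\ell^\infty(v)}\le A\|x\|_{\ell^\infty(1/u)}. \] (i) The least $A\in[0,\infty]$ such that $( * )$ holds for all $x\in\mathcal D(B)$ is $A(B)=\||B|u\|_{\ell^\infty(v)}$. (ii) The least $A\in[0,\infty]$ such that $( * )$ holds for all $x\in\ell^+\cap\mathcal D(B)$ is $A^+(B)=\max(\|B^+u\|_{\ell^\infty(v)},\|B^-u\|_{\ell^\infty(v)})$. (iii) Suppose each row of $B$ has positives before negatives and a nonnegative sum. The least $A\in[0,\infty]$ such that $( * )$ holds for all $x\in\ell^\downarrow\cap\mathcal D(B)$ is $A^\downarrow(B)=\|B^+(u^\downarrow)\|_{\ell^\infty(v)}$. (iv) Suppose each row of $B$ has negatives before positives and a nonnegative sum. If each row of $B$ has a finite sum, then the least $A\in[0,\infty]$ such that $( * )$ holds for all $x\in\ell^\uparrow\cap\mathcal D(B)$ is $A^\uparrow(B)=\|B^+(u^\uparrow)\|_{\ell^\infty(v)}$. If some row of $B$ has an infinite sum, then $\ell^\uparrow\cap\mathcal D(B)=\{0\}$, so $( * )$ holds trivially with $A^\uparrow(B)=0$.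
   Context: $\ell,\ell^+,\ell^\downarrow,\ell^\uparrow$ denote respectively the sets (indexed by positive integers) of all real sequences, all nonnegative real sequences, all nonincreasing sequences of nonnegative reals, and all nondecreasing sequences of nonnegative reals. $\mathcal D(B)$ is the set of real sequences $x$ such that for each $n$ the series $\sum_{k=1}^\infty b_{n,k}x_k$ converges (possibly conditionally) to a real number; then $(Bx)_n=\sum_{k=1}^\infty b_{n,k}x_k$. If all entries of a matrix and a sequence are nonnegative, the same notation is used with value $\infty$ allowed. For real $t$, $t^+=(|t|+t)/2$ and $t^-=(|t|-t)/2$; $B^+=(b_{n,k}^+)$, $B^-=(b_{n,k}^-)$, $|B|=(|b_{n,k}|)$. $u^\downarrow_k=\min_{j\le k}u_j$ and $u^\uparrow_k=\inf_{j\ge k}u_j$. A real sequence $b$ has positives before negatives if for all positive integers $j,k$, $b_j>0>b_k$ only if $j<k$; it has negatives before positives if $-b$ has positives before negatives. In either case the partial sums are eventually monotone, and the sum of $b$ is $\sum_{k=1}^\infty b_k\in[-\infty,\infty]$. Norms: $\|y\|_{\ell^\infty(v)}=\sup_n|y_n|v_n$ and $\|x\|_{\ell^\infty(1/u)}=\sup_k|x_k|/u_k$, both allowed to take the value $\infty$, where, if $u_k=0$, $|x_k|/u_k$ is $0$ when $x_k=0$ and $\infty$ when $x_k\neq0$. Some expressions need to be understood according to the convention $\infty\cdot0=0$.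
   Formalization: In ( * ), the right-hand side is read as ∞ whenever ‖x‖=∞, even for A=0; with 0·∞=0 there, no least A would exist, e.g. for u=0, v=1 and B the identity. Elsewhere ∞·0=0 is kept. *)

theory Defs
  imports "HOL-Library.Extended_Nonnegative_Real"
begin

text \<open>
  Sequences and matrices are indexed by the positive integers in the source. Here the index
  \<open>k :: nat\<close> stands for the positive integer \<open>k + 1\<close>; every notion below depends only on the
  order of the indices, so this is a mere relabelling.
\<close>

type_synonym rseq = "nat \<Rightarrow> real"
type_synonym rmatrix = "nat \<Rightarrow> nat \<Rightarrow> real"

definition nonneg_seqs :: "rseq set" where
  "nonneg_seqs = {x. \<forall>k. 0 \<le> x k}"

definition down_seqs :: "rseq set" where
  "down_seqs = {x \<in> nonneg_seqs. decseq x}"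

definition up_seqs :: "rseq set" where
  "up_seqs = {x \<in> nonneg_seqs. incseq x}"

text \<open>Summability of a real series is convergence of its partial sums, hence possibly conditional.\<close>

definition mat_domain :: "rmatrix \<Rightarrow> rseq set" where
  "mat_domain B = {x. \<forall>n. summable (\<lambda>k. B n k * x k)}"

definition mat_apply :: "rmatrix \<Rightarrow> rseq \<Rightarrow> rseq" where
  "mat_apply B x n = (\<Sum>k. B n k * x k)"

text \<open>
  The same operation with values in \<open>[0,\<infinity>]\<close>, for matrices and sequences with nonnegative entries
  only (\<open>ennreal\<close> sends negative reals to 0).
\<close>

definition mat_apply_nn :: "rmatrix \<Rightarrow> rseq \<Rightarrow> nat \<Rightarrow> ennreal" where
  "mat_apply_nn M y n = (\<Sum>k. ennreal (M n k * y k))"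

definition mat_abs :: "rmatrix \<Rightarrow> rmatrix" where
  "mat_abs B n k = \<bar>B n k\<bar>"

definition mat_pos :: "rmatrix \<Rightarrow> rmatrix" where
  "mat_pos B n k = (\<bar>B n k\<bar> + B n k) / 2"

definition mat_neg :: "rmatrix \<Rightarrow> rmatrix" where
  "mat_neg B n k = (\<bar>B n k\<bar> - B n k) / 2"

definition seq_down :: "rseq \<Rightarrow> rseq" where
  "seq_down u k = Min (u ` {..k})"

definition seq_up :: "rseq \<Rightarrow> rseq" where
  "seq_up u k = (INF j\<in>{k..}. u j)"

definition pos_before_neg :: "rseq \<Rightarrow> bool" where
  "pos_before_neg b \<longleftrightarrow> (\<forall>j k. b j > 0 \<and> 0 > b k \<longrightarrow> j < k)"

definition neg_before_pos :: "rseq \<Rightarrow> bool" where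
  "neg_before_pos b \<longleftrightarrow> pos_before_neg (\<lambda>k. - b k)"

text \<open>
  The sum in \<open>[-\<infinity>,\<infinity>]\<close>, i.e. the limit of the partial sums in \<open>ereal\<close>. It is used only for sequences
  satisfying one of the two predicates above, for which this limit exists because the partial sums
  are eventually monotone.
\<close>

definition ext_sum :: "rseq \<Rightarrow> ereal" where
  "ext_sum b = (\<Sum>k. ereal (b k))"

text \<open>
  The norm of \<open>\<ell>\<^sup>\<infinity>(v)\<close>, as a function of the sequence of absolute values \<open>y\<close>, which is allowed to take
  the value \<open>\<infinity>\<close>. Multiplication in \<open>ennreal\<close> satisfies \<open>\<infinity> * 0 = 0\<close>.
\<close>

definition wnorm_nn :: "rseq \<Rightarrow> (nat \<Rightarrow> ennreal) \<Rightarrow> ennreal" where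
  "wnorm_nn v y = (SUP n. y n * ennreal (v n))"

definition wnorm :: "rseq \<Rightarrow> rseq \<Rightarrow> ennreal" where
  "wnorm v y = wnorm_nn v (\<lambda>n. ennreal \<bar>y n\<bar>)"

text \<open>The norm of \<open>\<ell>\<^sup>\<infinity>(1/u)\<close>.\<close>

definition wnorm_recip :: "rseq \<Rightarrow> rseq \<Rightarrow> ennreal" where
  "wnorm_recip u x =
     (SUP k. if u k = 0 then (if x k = 0 then 0 else \<infinity>) else ennreal (\<bar>x k\<bar> / u k))"

text \<open>
  The right-hand side \<open>A \<parallel>x\<parallel>\<close> of the inequality: the inequality says nothing about sequences of
  infinite norm, not even for \<open>A = 0\<close>. The convention \<open>\<infinity> * 0 = 0\<close> is kept for \<open>A = \<infinity>\<close> and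
  \<open>\<parallel>x\<parallel> = 0\<close>. With the value 0 for \<open>A = 0\<close> and \<open>\<parallel>x\<parallel> = \<infinity>\<close> a least constant need not exist: for \<open>u = 0\<close>,
  \<open>v = 1\<close> and the identity matrix the admissible constants would be exactly those with \<open>A > 0\<close>.
\<close>

definition bound_rhs :: "ennreal \<Rightarrow> ennreal \<Rightarrow> ennreal" where
  "bound_rhs A t = (if t = \<infinity> then \<infinity> else A * t)"

definition norm_ineq :: "rseq \<Rightarrow> rseq \<Rightarrow> rmatrix \<Rightarrow> ennreal \<Rightarrow> rseq \<Rightarrow> bool" where
  "norm_ineq u v B A x \<longleftrightarrow> wnorm v (mat_apply B x) \<le> bound_rhs A (wnorm_recip u x)"

definition is_least_constant ::
    "rseq \<Rightarrow> rseq \<Rightarrow> rmatrix \<Rightarrow> rseq set \<Rightarrow> ennreal \<Rightarrow> bool" where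
  "is_least_constant u v B X C \<longleftrightarrow>
     (\<forall>x\<in>X. norm_ineq u v B C x) \<and>
     (\<forall>A. (\<forall>x\<in>X. norm_ineq u v B A x) \<longrightarrow> C \<le> A)"

end

theory Submission
  imports Defs
begin

text \<open>
  The weighted supremum norms decouple the rows of \<open>B\<close>. A sequence \<open>x\<close> has norm at most \<open>t < \<infinity>\<close> in
  \<open>\<ell>\<^sup>\<infinity>(1/u)\<close> exactly when \<open>\<bar>x k\<bar> \<le> t * u k\<close> for all \<open>k\<close>. Hence, if \<open>D n\<close> is the supremum of
  \<open>\<bar>(Bx) n\<bar>\<close> over those \<open>x\<close> in the given cone with \<open>\<bar>x k\<bar> \<le> u k\<close>, the least constant is the norm of
  \<open>D\<close> in \<open>\<ell>\<^sup>\<infinity>(v)\<close>; this is \<open>is_least_constant_rowwise\<close>. What remains is to compute \<open>D n\<close> for a single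
  row \<open>b\<close>, in each of the four cones.

  For all real \<open>x\<close> one takes the sign of \<open>x\<close> from \<open>b\<close>. For nonnegative \<open>x\<close> one puts \<open>x = u\<close> on the
  positive entries only, or on the negative entries only. In both cases \<open>x\<close> is cut off
  after finitely many terms, so that it belongs to the domain of \<open>B\<close>, and the cut-off is
  then moved to infinity.

  For monotone \<open>x\<close> the order of the signs matters. Positive entries meet the large values of a
  decreasing \<open>x\<close> when they come first, and those of an increasing \<open>x\<close> when they come last. With \<open>m\<close> an
  index at which the signs change, \<open>b k * (x k - x m) \<ge> 0\<close> for every \<open>k\<close>, so the sum of \<open>b k * x k\<close> is
  at least \<open>x m\<close> times the sum of \<open>b\<close> and hence nonnegative
  (\<open>suminf_mult_nonneg_of_sign_change\<close>). Dropping the negative entries therefore only increases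
  \<open>\<bar>(Bx) n\<bar>\<close>. Moreover a decreasing (increasing) \<open>x\<close> below \<open>u\<close> is already below the largest decreasing
  (increasing) minorant of \<open>u\<close>, which gives the upper bound. It is attained in the limit,
  because switching off \<open>x\<close> on the side of the negative entries preserves monotonicity. In the
  increasing case setting a tail to zero does not; there the sequence is frozen at a constant instead,
  and it lies in the domain because every row of \<open>B\<close> is summable. If some row sum is infinite, even
  these eventually constant sequences are lost and only \<open>x = 0\<close> remains.
\<close>

section \<open>Reduction to single rows\<close>

lemma abs_le_of_wnorm_recip:
  assumes "u \<in> nonneg_seqs" and "wnorm_recip u x = ennreal t" and "0 \<le> t"
  shows "\<bar>x k\<bar> \<le> t * u k"
proof -
  have le: "(if u k = 0 then (if x k = 0 then 0 else \<infinity>) else ennreal (\<bar>x k\<bar> / u k)) \<le> ennreal t"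
    unfolding assms(2)[symmetric] wnorm_recip_def by (rule SUP_upper) simp
  have u: "0 \<le> u k" using assms(1) by (simp add: nonneg_seqs_def)
  show ?thesis
  proof (cases "u k = 0")
    case True
    then show ?thesis using le by (auto split: if_splits simp: top_unique)
  next
    case False
    then have "\<bar>x k\<bar> / u k \<le> t" using le assms(3) by simp
    then show ?thesis using False u by (simp add: divide_le_eq)
  qed
qed

lemma wnorm_recip_le_1:
  assumes "\<And>k. \<bar>x k\<bar> \<le> u k"
  shows "wnorm_recip u x \<le> 1"
  unfolding wnorm_recip_def
proof (rule SUP_least)
  fix k
  have u: "0 \<le> u k" using assms[of k] by linarith
  have "ennreal (\<bar>x k\<bar> / u k) \<le> 1" if "u k \<noteq> 0"
    using assms[of k] u that by (simp add: divide_le_eq_1)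
  then show "(if u k = 0 then (if x k = 0 then 0 else \<infinity>) else ennreal (\<bar>x k\<bar> / u k)) \<le> 1"
    using assms[of k] by auto
qed

text \<open>
  For a cone \<open>X\<close> the two hypotheses together say that \<open>D n\<close> is the supremum of \<open>\<bar>(Bx) n\<bar>\<close> over the
  \<open>x \<in> X\<close> with \<open>\<bar>x k\<bar> \<le> u k\<close> for all \<open>k\<close>; the factor \<open>t\<close> builds in the homogeneity. Suprema over \<open>n\<close> and over \<open>x\<close> commute, which is why one can treat the rows one at a time.
\<close>

lemma is_least_constant_rowwise:
  assumes u: "u \<in> nonneg_seqs"
    and upper: "\<And>n x t. x \<in> X \<Longrightarrow> 0 \<le> t \<Longrightarrow> (\<And>k. \<bar>x k\<bar> \<le> t * u k)
        \<Longrightarrow> ennreal \<bar>mat_apply B x n\<bar> \<le> ennreal t * D n"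
    and lower: "\<And>n y. y < D n
        \<Longrightarrow> \<exists>x\<in>X. (\<forall>k. \<bar>x k\<bar> \<le> u k) \<and> y \<le> ennreal \<bar>mat_apply B x n\<bar>"
  shows "is_least_constant u v B X (wnorm_nn v D)"
  unfolding is_least_constant_def
proof (intro conjI ballI allI impI)
  fix x assume x: "x \<in> X"
  show "norm_ineq u v B (wnorm_nn v D) x"
  proof (cases "wnorm_recip u x")
    case (real t)
    have "ennreal \<bar>mat_apply B x n\<bar> * ennreal (v n) \<le> wnorm_nn v D * ennreal t" for n
    proof -
      have "ennreal \<bar>mat_apply B x n\<bar> * ennreal (v n) \<le> ennreal t * D n * ennreal (v n)"
        using real by (intro mult_right_mono upper x abs_le_of_wnorm_recip[OF u]) auto
      also have "\<dots> = (D n * ennreal (v n)) * ennreal t" by (simp add: ac_simps)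
      also have "\<dots> \<le> wnorm_nn v D * ennreal t"
        unfolding wnorm_nn_def by (intro mult_right_mono SUP_upper) auto
      finally show ?thesis .
    qed
    then show ?thesis
      by (auto simp: norm_ineq_def bound_rhs_def wnorm_def wnorm_nn_def[of _ "\<lambda>n. ennreal \<bar>_ n\<bar>"]
          real intro!: SUP_least)
  next
    case top
    then show ?thesis by (simp add: norm_ineq_def bound_rhs_def)
  qed
next
  fix A assume A: "\<forall>x\<in>X. norm_ineq u v B A x"
  show "wnorm_nn v D \<le> A" unfolding wnorm_nn_def
  proof (rule SUP_least)
    fix n
    have le: "y * ennreal (v n) \<le> A" if y: "y < D n" for y
    proof -
      obtain x where x: "x \<in> X" "\<And>k. \<bar>x k\<bar> \<le> u k" "y \<le> ennreal \<bar>mat_apply B x n\<bar>"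
        using lower[OF y] by auto
      have n1: "wnorm_recip u x \<le> 1" by (rule wnorm_recip_le_1) (rule x)
      have "y * ennreal (v n) \<le> ennreal \<bar>mat_apply B x n\<bar> * ennreal (v n)"
        using x(3) by (intro mult_right_mono) auto
      also have "\<dots> \<le> wnorm v (mat_apply B x)"
        unfolding wnorm_def wnorm_nn_def by (rule SUP_upper) simp
      also have "\<dots> \<le> bound_rhs A (wnorm_recip u x)"
        using A x(1) by (auto simp: norm_ineq_def)
      also have "\<dots> \<le> A"
        using n1 mult_left_mono[OF n1, of A] by (auto simp: bound_rhs_def top_unique)
      finally show ?thesis .
    qed
    have "D n = (SUP y\<in>{..<D n}. y)"
      by (cases "D n = 0") (auto simp: Sup_lessThan bot_ennreal)
    then have "D n * ennreal (v n) = (SUP y\<in>{..<D n}. y) * ennreal (v n)" by simp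
    also have "\<dots> = (SUP y\<in>{..<D n}. y * ennreal (v n))"
      by (rule SUP_mult_right_ennreal)
    also have "\<dots> \<le> A" using le by (intro SUP_least) auto
    finally show "D n * ennreal (v n) \<le> A" .
  qed
qed

section \<open>Row sums with values in the extended half-line\<close>

lemma ennreal_suminf_le:
  fixes f g :: "nat \<Rightarrow> real"
  assumes "summable f" and "\<And>k. f k \<le> g k" and "\<And>k. 0 \<le> g k"
  shows "ennreal (\<Sum>k. f k) \<le> (\<Sum>k. ennreal (g k))"
proof (cases "(\<Sum>k. ennreal (g k)) = top")
  case False
  then have "summable g" using assms(3) summable_suminf_not_top by blast
  then show ?thesis
    using assms by (simp add: suminf_ennreal2 suminf_le ennreal_leI)
qed simp

lemma mat_apply_le_mat_apply_nn:
  assumes "summable (\<lambda>k. B n k * x k)"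
    and "\<And>k. B n k * x k \<le> M n k * (t * y k)"
    and "0 \<le> t" and "\<And>k. 0 \<le> M n k * y k"
  shows "ennreal (mat_apply B x n) \<le> ennreal t * mat_apply_nn M y n"
proof -
  have "ennreal (mat_apply B x n) \<le> (\<Sum>k. ennreal (t * (M n k * y k)))"
    unfolding mat_apply_def using assms
    by (intro ennreal_suminf_le) (auto simp: ac_simps)
  also have "\<dots> = ennreal t * mat_apply_nn M y n"
    unfolding mat_apply_nn_def using assms by (simp add: ennreal_mult')
  finally show ?thesis .
qed

lemma less_mat_apply_nn_imp_partial_sum:
  assumes "y < mat_apply_nn M w n" and "\<And>k. 0 \<le> M n k * w k"
  obtains N where "y \<le> ennreal (\<Sum>k<N. M n k * w k)"
proof -
  have "y < (SUP N. \<Sum>k<N. ennreal (M n k * w k))"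
    using assms(1) unfolding mat_apply_nn_def by (simp add: suminf_eq_SUP)
  then obtain N where "y < (\<Sum>k<N. ennreal (M n k * w k))"
    by (auto simp: less_SUP_iff)
  then show ?thesis using that[of N] assms(2) by (simp add: sum_ennreal)
qed

lemma finite_support_in_mat_domain:
  assumes "\<And>k. N \<le> k \<Longrightarrow> x k = 0"
  shows "x \<in> mat_domain B"
proof -
  have "summable (\<lambda>k. B n k * x k)" for n
    using assms by (intro summable_finite[of "{..<N}"]) auto
  then show ?thesis by (simp add: mat_domain_def)
qed

lemma mat_apply_finite_support:
  assumes "\<And>k. N \<le> k \<Longrightarrow> x k = 0"
  shows "mat_apply B x n = (\<Sum>k<N. B n k * x k)"
  unfolding mat_apply_def using assms by (intro suminf_finite) auto

lemma mat_pos_nonneg: "0 \<le> mat_pos B n k"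
  and mat_neg_nonneg: "0 \<le> mat_neg B n k"
  and mat_abs_nonneg: "0 \<le> mat_abs B n k"
  and mat_pos_eq: "mat_pos B n k = max 0 (B n k)"
  and mat_neg_eq: "mat_neg B n k = max 0 (- B n k)"
  by (auto simp: mat_pos_def mat_neg_def mat_abs_def)

section \<open>Real and nonnegative sequences\<close>

theorem is_least_constant_all:
  assumes u: "u \<in> nonneg_seqs"
  shows "is_least_constant u v B (mat_domain B) (wnorm_nn v (mat_apply_nn (mat_abs B) u))"
proof (rule is_least_constant_rowwise[OF u])
  have u0: "0 \<le> u k" for k using u by (simp add: nonneg_seqs_def)
  fix n
  show "ennreal \<bar>mat_apply B x n\<bar> \<le> ennreal t * mat_apply_nn (mat_abs B) u n"
    if x: "x \<in> mat_domain B" and t: "0 \<le> t" and le: "\<And>k. \<bar>x k\<bar> \<le> t * u k" for x t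
  proof -
    have s: "summable (\<lambda>k. B n k * x k)" using x by (simp add: mat_domain_def)
    have abs_le: "\<bar>B n k * x k\<bar> \<le> mat_abs B n k * (t * u k)" for k
      by (simp add: abs_mult mat_abs_def mult_left_mono le)
    have "ennreal (mat_apply B x n) \<le> ennreal t * mat_apply_nn (mat_abs B) u n"
      using abs_le t u0 mat_abs_nonneg
      by (intro mat_apply_le_mat_apply_nn s) (auto simp: abs_le_iff)
    moreover have "ennreal (mat_apply B (\<lambda>k. - x k) n) \<le> ennreal t * mat_apply_nn (mat_abs B) u n"
      using abs_le t u0 mat_abs_nonneg s
      by (intro mat_apply_le_mat_apply_nn) (auto simp: abs_le_iff summable_minus_iff)
    moreover have "mat_apply B (\<lambda>k. - x k) n = - mat_apply B x n"
      by (simp add: mat_apply_def suminf_minus s)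
    ultimately show ?thesis by (simp add: abs_if)
  qed
  show "\<exists>x\<in>mat_domain B. (\<forall>k. \<bar>x k\<bar> \<le> u k) \<and> y \<le> ennreal \<bar>mat_apply B x n\<bar>"
    if y: "y < mat_apply_nn (mat_abs B) u n" for y
  proof -
    obtain N where N: "y \<le> ennreal (\<Sum>k<N. mat_abs B n k * u k)"
      using less_mat_apply_nn_imp_partial_sum[OF y] u0 mat_abs_nonneg by auto
    define x where "x k = (if k < N then sgn (B n k) * u k else 0)" for k
    have "mat_apply B x n = (\<Sum>k<N. B n k * x k)"
      by (rule mat_apply_finite_support) (simp add: x_def)
    also have "\<dots> = (\<Sum>k<N. mat_abs B n k * u k)"
      by (intro sum.cong) (auto simp: x_def mat_abs_def sgn_if)
    finally have "y \<le> ennreal \<bar>mat_apply B x n\<bar>"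
      using N by (metis abs_ge_self ennreal_leI order_trans)
    moreover have "\<bar>x k\<bar> \<le> u k" for k using u0[of k] by (simp add: x_def abs_mult sgn_if)
    moreover have "x \<in> mat_domain B"
      by (rule finite_support_in_mat_domain[of N]) (simp add: x_def)
    ultimately show ?thesis by blast
  qed
qed

lemma wnorm_nn_max:
  "wnorm_nn v (\<lambda>n. max (y n) (z n)) = max (wnorm_nn v y) (wnorm_nn v z)"
proof -
  have "max (y n) (z n) * ennreal (v n) = max (y n * ennreal (v n)) (z n * ennreal (v n))" for n
    by (metis max.orderE max.commute linear max_def mult_right_mono zero_le)
  then show ?thesis
    by (simp add: wnorm_nn_def SUP_sup_distrib[symmetric] sup_max[symmetric])
qed

theorem is_least_constant_nonneg:
  assumes u: "u \<in> nonneg_seqs"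
  shows "is_least_constant u v B (nonneg_seqs \<inter> mat_domain B)
    (max (wnorm_nn v (mat_apply_nn (mat_pos B) u)) (wnorm_nn v (mat_apply_nn (mat_neg B) u)))"
  unfolding wnorm_nn_max[symmetric]
proof (rule is_least_constant_rowwise[OF u])
  have u0: "0 \<le> u k" for k using u by (simp add: nonneg_seqs_def)
  fix n
  let ?D = "max (mat_apply_nn (mat_pos B) u n) (mat_apply_nn (mat_neg B) u n)"
  show "ennreal \<bar>mat_apply B x n\<bar> \<le> ennreal t * ?D"
    if x: "x \<in> nonneg_seqs \<inter> mat_domain B" and t: "0 \<le> t" and le: "\<And>k. \<bar>x k\<bar> \<le> t * u k" for x t
  proof -
    have s: "summable (\<lambda>k. B n k * x k)" using x by (simp add: mat_domain_def)
    have x0: "0 \<le> x k" for k using x by (simp add: nonneg_seqs_def)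
    have x_le: "x k \<le> t * u k" for k using le[of k] by linarith
    have pos: "B n k * x k \<le> mat_pos B n k * (t * u k)" for k
      using x0 x_le by (intro mult_mono) (auto simp: mat_pos_eq)
    have neg: "- B n k * x k \<le> mat_neg B n k * (t * u k)" for k
      using x0 x_le by (intro mult_mono) (auto simp: mat_neg_eq)
    have "ennreal (mat_apply B x n) \<le> ennreal t * mat_apply_nn (mat_pos B) u n"
      using pos t u0 mat_pos_nonneg by (intro mat_apply_le_mat_apply_nn s) auto
    also have "\<dots> \<le> ennreal t * ?D" by (intro mult_left_mono) auto
    finally have 1: "ennreal (mat_apply B x n) \<le> ennreal t * ?D" .
    have "ennreal (mat_apply B (\<lambda>k. - x k) n) \<le> ennreal t * mat_apply_nn (mat_neg B) u n"
      using neg t u0 mat_neg_nonneg s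
      by (intro mat_apply_le_mat_apply_nn) (auto simp: summable_minus_iff)
    also have "\<dots> \<le> ennreal t * ?D" by (intro mult_left_mono) auto
    also have "mat_apply B (\<lambda>k. - x k) n = - mat_apply B x n"
      by (simp add: mat_apply_def suminf_minus s)
    finally show ?thesis using 1 by (simp add: abs_if)
  qed
  have witness: "\<exists>x\<in>nonneg_seqs \<inter> mat_domain B. (\<forall>k. \<bar>x k\<bar> \<le> u k) \<and> y \<le> ennreal \<bar>mat_apply B x n\<bar>"
    if N: "y \<le> ennreal (\<Sum>k<N. M k * u k)"
      and c: "\<And>k. M k = max 0 (c * B n k)" "\<bar>c\<bar> = 1" for y N M c
  proof -
    define x where "x k = (if k < N \<and> 0 < c * B n k then u k else 0)" for k
    have "c * mat_apply B x n = (\<Sum>k<N. c * (B n k * x k))"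
      by (subst mat_apply_finite_support[of N]) (auto simp: x_def sum_distrib_left)
    also have "\<dots> = (\<Sum>k<N. M k * u k)"
      by (intro sum.cong) (auto simp: x_def c max_def)
    finally have "\<bar>mat_apply B x n\<bar> \<ge> (\<Sum>k<N. M k * u k)"
      using c(2) by (metis abs_ge_self abs_mult mult_1)
    then have "y \<le> ennreal \<bar>mat_apply B x n\<bar>"
      using N by (metis ennreal_leI order_trans)
    moreover have "\<bar>x k\<bar> \<le> u k" for k using u0[of k] by (simp add: x_def)
    moreover have "x \<in> mat_domain B"
      by (rule finite_support_in_mat_domain[of N]) (simp add: x_def)
    moreover have "x \<in> nonneg_seqs" using u0 by (simp add: nonneg_seqs_def x_def)
    ultimately show ?thesis by blast
  qed
  show "\<exists>x\<in>nonneg_seqs \<inter> mat_domain B. (\<forall>k. \<bar>x k\<bar> \<le> u k) \<and> y \<le> ennreal \<bar>mat_apply B x n\<bar>"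
    if y: "y < ?D" for y
  proof -
    consider "y < mat_apply_nn (mat_pos B) u n" | "y < mat_apply_nn (mat_neg B) u n"
      using y by (auto simp: less_max_iff_disj)
    then show ?thesis
    proof cases
      case 1
      obtain N where "y \<le> ennreal (\<Sum>k<N. mat_pos B n k * u k)"
        using less_mat_apply_nn_imp_partial_sum[OF 1] u0 mat_pos_nonneg by auto
      then show ?thesis by (rule witness[where c = 1]) (auto simp: mat_pos_eq)
    next
      case 2
      obtain N where "y \<le> ennreal (\<Sum>k<N. mat_neg B n k * u k)"
        using less_mat_apply_nn_imp_partial_sum[OF 2] u0 mat_neg_nonneg by auto
      then show ?thesis by (rule witness[where c = "-1"]) (auto simp: mat_neg_eq)
    qed
  qed
qed

section \<open>Sums of rows with one sign change\<close>

lemma ext_sum_summable: "summable b \<Longrightarrow> ext_sum b = ereal (\<Sum>k. b k)"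
  by (simp add: ext_sum_def sums_ereal summable_sums sums_unique[symmetric])

text \<open>
  A series in the extended reals need not have a sum, and then \<open>ext_sum\<close> carries no information.
  Here the partial sums increase from index \<open>m\<close> on, so they converge to their supremum, which is
  bounded below by the finite partial sum at \<open>m\<close>.
\<close>

lemma ext_sum_eventually_nonneg:
  assumes "\<And>k. m \<le> k \<Longrightarrow> 0 \<le> b k"
  shows "(\<lambda>k. ereal (b k)) sums ext_sum b" and "ext_sum b \<noteq> - \<infinity>"
proof -
  define T where "T n = (\<Sum>k<n + m. ereal (b k))" for n
  have "incseq T" unfolding T_def using assms by (intro incseq_SucI) (simp add: add_increasing2)
  then have "T \<longlonglongrightarrow> (SUP n. T n)" by (rule LIMSEQ_SUP)
  then have sums: "(\<lambda>k. ereal (b k)) sums (SUP n. T n)"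
    unfolding sums_def T_def by (rule LIMSEQ_offset)
  then have eq: "ext_sum b = (SUP n. T n)" unfolding ext_sum_def by (rule sums_unique[symmetric])
  show "(\<lambda>k. ereal (b k)) sums ext_sum b" using sums eq by simp
  have "T 0 \<le> ext_sum b" unfolding eq by (rule SUP_upper) simp
  then show "ext_sum b \<noteq> - \<infinity>" by (auto simp: T_def)
qed

lemma summable_of_ext_sum:
  assumes "(\<lambda>k. ereal (b k)) sums L" and "\<bar>L\<bar> \<noteq> \<infinity>"
  shows "summable b"
  using assms by (cases L) (auto simp: sums_ereal summable_def)

lemma summable_of_eventually_nonpos:
  assumes "\<And>k. m \<le> k \<Longrightarrow> b k \<le> 0" and "0 \<le> ext_sum b"
  shows "summable b"
proof -
  have L: "(\<lambda>k. ereal (- b k)) sums ext_sum (\<lambda>k. - b k)" "ext_sum (\<lambda>k. - b k) \<noteq> - \<infinity>"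
    using assms(1) ext_sum_eventually_nonneg[of m "\<lambda>k. - b k"] by auto
  have "(\<lambda>n. - (\<Sum>k<n. ereal (- b k))) \<longlonglongrightarrow> - ext_sum (\<lambda>k. - b k)"
    using L(1) unfolding sums_def by (rule tendsto_uminus_ereal)
  then have sums: "(\<lambda>k. ereal (b k)) sums (- ext_sum (\<lambda>k. - b k))"
    by (simp add: sums_def sum_ereal sum_negf)
  then have "ext_sum b = - ext_sum (\<lambda>k. - b k)"
    unfolding ext_sum_def by (rule sums_unique[symmetric])
  then have "\<bar>- ext_sum (\<lambda>k. - b k)\<bar> \<noteq> \<infinity>"
    using assms(2) L(2) by (cases "ext_sum (\<lambda>k. - b k)") auto
  with sums show ?thesis by (rule summable_of_ext_sum)
qed

text \<open>
  The constant \<open>x m\<close> is a minorant of \<open>x\<close> where \<open>b\<close> is positive and a majorant where \<open>b\<close> is negative.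
  Termwise comparison of \<open>\<Sum>k. b k * x k\<close> with \<open>\<Sum>k. x m * b k\<close> takes the place of summation by parts and
  applies to conditionally convergent series as well.
\<close>

lemma suminf_mult_nonneg_of_sign_change:
  fixes b x :: "nat \<Rightarrow> real"
  assumes "summable b" and "0 \<le> (\<Sum>k. b k)" and "summable (\<lambda>k. b k * x k)"
    and "0 \<le> x m" and "\<And>k. 0 \<le> b k * (x k - x m)"
  shows "0 \<le> (\<Sum>k. b k * x k)"
proof -
  have "0 \<le> x m * (\<Sum>k. b k)" using assms by simp
  also have "\<dots> = (\<Sum>k. x m * b k)" using assms(1) by (rule suminf_mult[symmetric])
  also have "\<dots> \<le> (\<Sum>k. b k * x k)"
    using assms by (intro suminf_le summable_mult) (auto simp: algebra_simps)
  finally show ?thesis .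
qed

section \<open>Decreasing sequences\<close>

lemma seq_down_le: "j \<le> k \<Longrightarrow> seq_down u k \<le> u j"
  by (simp add: seq_down_def)

lemma seq_down_attained: "\<exists>j\<le>k. seq_down u k = u j"
proof -
  have "Min (u ` {..k}) \<in> u ` {..k}" by (rule Min_in) auto
  then show ?thesis unfolding seq_down_def by blast
qed

lemma decseq_seq_down: "decseq (seq_down u)"
  by (auto simp: decseq_def seq_down_def intro!: Min_antimono)

lemma seq_down_nonneg: "u \<in> nonneg_seqs \<Longrightarrow> 0 \<le> seq_down u k"
  using seq_down_attained[of k u] by (auto simp: nonneg_seqs_def)

lemma decseq_le_seq_down:
  assumes "decseq x" and "\<And>k. x k \<le> t * u k"
  shows "x k \<le> t * seq_down u k"
  using seq_down_attained[of k u] assms by (metis decseqD order_trans)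

lemma suminf_decseq_nonneg:
  assumes b: "pos_before_neg b" "0 \<le> ext_sum b" and x: "x \<in> down_seqs"
    and s: "summable (\<lambda>k. b k * x k)"
  shows "0 \<le> (\<Sum>k. b k * x k)"
proof (cases "\<exists>m. b m < 0")
  case False
  then show ?thesis using x s
    by (intro suminf_nonneg) (auto simp: down_seqs_def nonneg_seqs_def not_less)
next
  case True
  \<comment> \<open>The first negative entry serves as the sign change: nothing before it is negative by
    minimality, nothing after it is positive by hypothesis.\<close>
  define m where "m = (LEAST m. b m < 0)"
  have m: "b m < 0" unfolding m_def using True by (rule LeastI_ex)
  have before: "0 \<le> b k" if "k < m" for k
    using not_less_Least that unfolding m_def by (metis not_less)
  have after: "b k \<le> 0" if "m \<le> k" for k
    using b(1) m that by (meson leD not_less pos_before_neg_def)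
  have sb: "summable b" using after b(2) by (rule summable_of_eventually_nonpos)
  have "0 \<le> b k * (x k - x m)" for k
  proof (cases "k < m")
    case True
    then show ?thesis using before x by (auto simp: down_seqs_def decseq_def)
  next
    case False
    then show ?thesis using after x by (auto simp: down_seqs_def decseq_def mult_nonpos_nonpos)
  qed
  then show ?thesis
    using sb b(2) s x
    by (intro suminf_mult_nonneg_of_sign_change[of b x m])
      (auto simp: ext_sum_summable down_seqs_def nonneg_seqs_def)
qed

theorem is_least_constant_down:
  assumes u: "u \<in> nonneg_seqs"
    and rows: "\<And>n. pos_before_neg (B n)" "\<And>n. 0 \<le> ext_sum (B n)"
  shows "is_least_constant u v B (down_seqs \<inter> mat_domain B)
    (wnorm_nn v (mat_apply_nn (mat_pos B) (seq_down u)))"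
proof (rule is_least_constant_rowwise[OF u])
  note w0 = seq_down_nonneg[OF u]
  fix n
  show "ennreal \<bar>mat_apply B x n\<bar> \<le> ennreal t * mat_apply_nn (mat_pos B) (seq_down u) n"
    if x: "x \<in> down_seqs \<inter> mat_domain B" and t: "0 \<le> t" and le: "\<And>k. \<bar>x k\<bar> \<le> t * u k" for x t
  proof -
    have s: "summable (\<lambda>k. B n k * x k)" using x by (simp add: mat_domain_def)
    have x0: "0 \<le> x k" for k using x by (simp add: down_seqs_def nonneg_seqs_def)
    have "x k \<le> t * u k" for k using le[of k] by linarith
    then have x_le: "x k \<le> t * seq_down u k" for k
      using x by (intro decseq_le_seq_down) (auto simp: down_seqs_def)
    have "0 \<le> mat_apply B x n"
      unfolding mat_apply_def using x s by (intro suminf_decseq_nonneg rows) auto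
    moreover have "B n k * x k \<le> mat_pos B n k * (t * seq_down u k)" for k
      using x0 x_le by (intro mult_mono) (auto simp: mat_pos_eq)
    ultimately show ?thesis
      using mat_apply_le_mat_apply_nn[where B = B and x = x and M = "mat_pos B", of n t "seq_down u"]
        s t w0 mat_pos_nonneg by simp
  qed
  show "\<exists>x\<in>down_seqs \<inter> mat_domain B. (\<forall>k. \<bar>x k\<bar> \<le> u k) \<and> y \<le> ennreal \<bar>mat_apply B x n\<bar>"
    if y: "y < mat_apply_nn (mat_pos B) (seq_down u) n" for y
  proof -
    obtain N where N: "y \<le> ennreal (\<Sum>k<N. mat_pos B n k * seq_down u k)"
      using less_mat_apply_nn_imp_partial_sum[OF y] w0 mat_pos_nonneg by auto
    \<comment> \<open>The cut-off comes at \<open>N\<close> or at the first negative entry, whichever is earlier; no positive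
      entry is lost by the latter.\<close>
    define x where
      "x k = (if k < N \<and> (\<forall>j\<le>k. 0 \<le> B n j) then seq_down u k else 0)" for k
    have "mat_apply B x n = (\<Sum>k<N. B n k * x k)"
      by (rule mat_apply_finite_support) (simp add: x_def)
    also have "\<dots> = (\<Sum>k<N. mat_pos B n k * seq_down u k)"
    proof (rule sum.cong)
      fix k assume k: "k \<in> {..<N}"
      show "B n k * x k = mat_pos B n k * seq_down u k"
      proof (cases "\<forall>j\<le>k. 0 \<le> B n j")
        case True
        then show ?thesis using k by (simp add: x_def mat_pos_eq)
      next
        case False
        then have "B n k \<le> 0"
          using rows(1)[of n] by (meson leD not_less pos_before_neg_def)
        then show ?thesis using False by (auto simp: x_def mat_pos_eq)
      qed
    qed simp
    finally have "y \<le> ennreal \<bar>mat_apply B x n\<bar>"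
      using N by (metis abs_ge_self ennreal_leI order_trans)
    moreover have "\<bar>x k\<bar> \<le> u k" for k
      using w0[of k] seq_down_le[of k k u] by (auto simp: x_def)
    moreover have "x \<in> mat_domain B"
      by (rule finite_support_in_mat_domain[of N]) (simp add: x_def)
    moreover have "x \<in> down_seqs"
      using w0 decseqD[OF decseq_seq_down[of u]]
      by (auto simp: down_seqs_def nonneg_seqs_def decseq_def x_def)
    ultimately show ?thesis by blast
  qed
qed

section \<open>Increasing sequences\<close>

lemma bdd_below_nonneg_seq: "u \<in> nonneg_seqs \<Longrightarrow> bdd_below (u ` S)"
  by (auto simp: nonneg_seqs_def intro!: bdd_belowI[of _ 0])

lemma seq_up_le: "u \<in> nonneg_seqs \<Longrightarrow> k \<le> j \<Longrightarrow> seq_up u k \<le> u j"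
  unfolding seq_up_def by (intro cINF_lower bdd_below_nonneg_seq) auto

lemma seq_up_nonneg: "u \<in> nonneg_seqs \<Longrightarrow> 0 \<le> seq_up u k"
  unfolding seq_up_def by (intro cINF_greatest) (auto simp: nonneg_seqs_def)

lemma incseq_seq_up:
  assumes "u \<in> nonneg_seqs"
  shows "incseq (seq_up u)"
  unfolding incseq_def seq_up_def
  by (intro allI impI cINF_superset_mono bdd_below_nonneg_seq assms) auto

lemma incseq_le_seq_up:
  assumes "incseq x" and "0 \<le> t" and "\<And>k. x k \<le> t * u k"
  shows "x k \<le> t * seq_up u k"
proof (cases "t = 0")
  case True
  then show ?thesis using assms(3)[of k] by simp
next
  case False
  then have t: "0 < t" using assms(2) by simp
  have "x k / t \<le> seq_up u k" unfolding seq_up_def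
  proof (rule cINF_greatest)
    fix j assume "j \<in> {k..}"
    then have "x k \<le> t * u j" using assms(1,3) by (metis atLeast_iff incseqD order_trans)
    then show "x k / t \<le> u j" using t by (simp add: divide_le_eq mult.commute)
  qed simp
  then show ?thesis using t by (simp add: divide_le_eq mult.commute)
qed

lemma neg_before_pos_nonneg_after:
  assumes "neg_before_pos b" and "0 < b m" and "m \<le> k"
  shows "0 \<le> b k"
  using assms by (fastforce simp: neg_before_pos_def pos_before_neg_def not_less[symmetric])

lemma summable_of_neg_before_pos:
  assumes "neg_before_pos b" and "0 \<le> ext_sum b" and "\<bar>ext_sum b\<bar> \<noteq> \<infinity>"
  shows "summable b"
proof (cases "\<exists>m. 0 < b m")
  case True
  then obtain m where "0 < b m" by blast
  then have "(\<lambda>k. ereal (b k)) sums ext_sum b"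
    using neg_before_pos_nonneg_after[OF assms(1)]
    by (intro ext_sum_eventually_nonneg(1)[of m]) auto
  then show ?thesis using assms(3) by (rule summable_of_ext_sum)
next
  case False
  then show ?thesis
    using assms(2) by (intro summable_of_eventually_nonpos[of 0]) (auto simp: not_less)
qed

lemma suminf_incseq_nonneg:
  assumes b: "neg_before_pos b" "summable b" "0 \<le> (\<Sum>k. b k)" and x: "x \<in> up_seqs"
    and s: "summable (\<lambda>k. b k * x k)"
  shows "0 \<le> (\<Sum>k. b k * x k)"
proof (cases "\<exists>m. 0 < b m")
  case False
  \<comment> \<open>A row without positive entries and with nonnegative sum vanishes.\<close>
  then have nonpos: "b k \<le> 0" for k by (simp add: not_less)
  have "(\<Sum>k. - b k) = 0"
    using b nonpos by (intro antisym suminf_nonneg) (auto simp: suminf_minus summable_minus_iff)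
  then have "b k = 0" for k
    using suminf_eq_zero_iff[of "\<lambda>k. - b k"] b(2) nonpos by (auto simp: summable_minus_iff)
  then show ?thesis by simp
next
  case True
  define m where "m = (LEAST m. 0 < b m)"
  have m: "0 < b m" unfolding m_def using True by (rule LeastI_ex)
  have before: "b k \<le> 0" if "k < m" for k
    using not_less_Least that unfolding m_def by (metis not_less)
  note after = neg_before_pos_nonneg_after[OF b(1) m]
  have "0 \<le> b k * (x k - x m)" for k
  proof (cases "k < m")
    case True
    then show ?thesis
      using before x by (auto simp: up_seqs_def incseq_def mult_nonpos_nonpos)
  next
    case False
    then show ?thesis using after x by (auto simp: up_seqs_def incseq_def)
  qed
  then show ?thesis
    using b s x by (intro suminf_mult_nonneg_of_sign_change[of b x m])
      (auto simp: up_seqs_def nonneg_seqs_def)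
qed

lemma eventually_constant_in_mat_domain:
  assumes "\<And>n. summable (B n)" and "\<And>k. K \<le> k \<Longrightarrow> x k = c"
  shows "x \<in> mat_domain B"
proof -
  have "summable (\<lambda>k. B n k * x k)" for n
  proof -
    have "\<forall>\<^sub>F k in sequentially. B n k * x k = B n k * c"
      using assms(2) by (auto simp: eventually_sequentially)
    then have "summable (\<lambda>k. B n k * x k) \<longleftrightarrow> summable (\<lambda>k. B n k * c)" by (rule summable_cong)
    then show ?thesis using assms(1) by (simp add: summable_mult2)
  qed
  then show ?thesis by (simp add: mat_domain_def)
qed

theorem is_least_constant_up:
  assumes u: "u \<in> nonneg_seqs"
    and rows: "\<And>n. neg_before_pos (B n)" "\<And>n. 0 \<le> ext_sum (B n)"
      "\<And>n. \<bar>ext_sum (B n)\<bar> \<noteq> \<infinity>"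
  shows "is_least_constant u v B (up_seqs \<inter> mat_domain B)
    (wnorm_nn v (mat_apply_nn (mat_pos B) (seq_up u)))"
proof (rule is_least_constant_rowwise[OF u])
  note w0 = seq_up_nonneg[OF u]
  have sB: "summable (B n)" for n using rows by (intro summable_of_neg_before_pos)
  have B0: "0 \<le> (\<Sum>k. B n k)" for n using rows(2)[of n] by (simp add: ext_sum_summable sB)
  fix n
  show "ennreal \<bar>mat_apply B x n\<bar> \<le> ennreal t * mat_apply_nn (mat_pos B) (seq_up u) n"
    if x: "x \<in> up_seqs \<inter> mat_domain B" and t: "0 \<le> t" and le: "\<And>k. \<bar>x k\<bar> \<le> t * u k" for x t
  proof -
    have s: "summable (\<lambda>k. B n k * x k)" using x by (simp add: mat_domain_def)
    have x0: "0 \<le> x k" for k using x by (simp add: up_seqs_def nonneg_seqs_def)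
    have "x k \<le> t * u k" for k using le[of k] by linarith
    then have x_le: "x k \<le> t * seq_up u k" for k
      using x t by (intro incseq_le_seq_up) (auto simp: up_seqs_def)
    have "0 \<le> mat_apply B x n"
      unfolding mat_apply_def using x s by (intro suminf_incseq_nonneg rows sB B0) auto
    moreover have "B n k * x k \<le> mat_pos B n k * (t * seq_up u k)" for k
      using x0 x_le by (intro mult_mono) (auto simp: mat_pos_eq)
    ultimately show ?thesis
      using mat_apply_le_mat_apply_nn[where B = B and x = x and M = "mat_pos B", of n t "seq_up u"]
        s t w0 mat_pos_nonneg by simp
  qed
  show "\<exists>x\<in>up_seqs \<inter> mat_domain B. (\<forall>k. \<bar>x k\<bar> \<le> u k) \<and> y \<le> ennreal \<bar>mat_apply B x n\<bar>"
    if y: "y < mat_apply_nn (mat_pos B) (seq_up u) n" for y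
  proof -
    obtain N where N: "y \<le> ennreal (\<Sum>k<N. mat_pos B n k * seq_up u k)"
      using less_mat_apply_nn_imp_partial_sum[OF y] w0 mat_pos_nonneg by auto
    \<comment> \<open>The sequence starts at the first positive entry, which avoids all negative ones, and is
      frozen from \<open>N\<close> on, as \<open>seq_up u\<close> itself need not lie in the domain of \<open>B\<close>.\<close>
    define x where "x k = (if \<exists>j\<le>k. 0 < B n j then seq_up u (min k N) else 0)" for k
    have mono: "seq_up u i \<le> seq_up u j" if "i \<le> j" for i j
      using incseq_seq_up[OF u] that by (rule incseqD)
    have x: "x \<in> up_seqs"
      unfolding up_seqs_def nonneg_seqs_def incseq_def x_def
      using w0 by (auto intro!: mono dest: order_trans)
    have "\<exists>K c. \<forall>k\<ge>K. x k = c"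
    proof (cases "\<exists>p. 0 < B n p")
      case True
      then obtain p where p: "0 < B n p" by blast
      then have "\<forall>k\<ge>max p N. x k = seq_up u N" by (auto simp: x_def min_def)
      then show ?thesis by blast
    next
      case False
      then have "\<forall>k\<ge>0. x k = 0" by (auto simp: x_def)
      then show ?thesis by blast
    qed
    then have dom: "x \<in> mat_domain B"
      using sB eventually_constant_in_mat_domain by blast
    have eq: "B n k * x k = mat_pos B n k * seq_up u (min k N)" for k
    proof (cases "\<exists>j\<le>k. 0 < B n j")
      case True
      then have "0 \<le> B n k" using neg_before_pos_nonneg_after[OF rows(1)[of n]] by blast
      then show ?thesis using True by (simp add: x_def mat_pos_eq)
    next
      case False
      then show ?thesis by (auto simp: x_def mat_pos_eq not_less)
    qed
    have s: "summable (\<lambda>k. B n k * x k)" using dom by (simp add: mat_domain_def)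
    have "(\<Sum>k<N. mat_pos B n k * seq_up u k) = (\<Sum>k<N. B n k * x k)"
      by (intro sum.cong) (auto simp: eq)
    also have "\<dots> \<le> mat_apply B x n"
      unfolding mat_apply_def using w0 mat_pos_nonneg
      by (intro sum_le_suminf s) (auto simp: eq)
    finally have "y \<le> ennreal \<bar>mat_apply B x n\<bar>"
      using N by (metis abs_ge_self ennreal_leI order_trans)
    moreover have "\<bar>x k\<bar> \<le> u k" for k
      using w0 seq_up_le[OF u, of "min k N" k] order_trans[OF w0 seq_up_le[OF u order_refl]]
      by (auto simp: x_def)
    ultimately show ?thesis using x dom by blast
  qed
qed

text \<open>
  An increasing \<open>x \<noteq> 0\<close> is bounded below by some \<open>x K > 0\<close> from index \<open>K\<close> on, and the entries of the
  row are eventually nonnegative. Hence the sum of \<open>b k * x k\<close> eventually dominates \<open>x K\<close> times the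
  divergent sum of the \<open>b k\<close>.
\<close>

lemma up_seqs_inter_mat_domain_infinite_row:
  assumes b: "neg_before_pos (B n)" "0 \<le> ext_sum (B n)" "\<bar>ext_sum (B n)\<bar> = \<infinity>"
  shows "up_seqs \<inter> mat_domain B = {\<lambda>k. 0}"
proof -
  have div: "\<not> summable (B n)" using b(3) by (auto simp: ext_sum_summable)
  have "\<exists>m. 0 < B n m"
    using summable_of_eventually_nonpos[of 0 "B n"] b(2) div by (meson not_less)
  then obtain m where m: "0 < B n m" by blast
  have "x K = 0" if x: "x \<in> up_seqs" "x \<in> mat_domain B" for x K
  proof (rule ccontr)
    assume "x K \<noteq> 0"
    then have pos: "0 < x K"
      using x(1) by (metis (mono_tags, lifting) mem_Collect_eq nonneg_seqs_def order_le_less up_seqs_def)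
    have "summable (B n)"
    proof (rule summable_comparison_test')
      show "summable (\<lambda>k. (B n k * x k) / x K)"
        using x(2) by (intro summable_divide) (simp add: mat_domain_def)
      fix k assume k: "max m K \<le> k"
      then have "0 \<le> B n k" using neg_before_pos_nonneg_after[OF b(1) m] by simp
      moreover have "x K \<le> x k" using x(1) k by (simp add: up_seqs_def incseqD)
      ultimately show "norm (B n k) \<le> (B n k * x k) / x K"
        using pos by (simp add: le_divide_eq mult_left_mono)
    qed
    with div show False by simp
  qed
  moreover have "(\<lambda>k. 0) \<in> up_seqs \<inter> mat_domain B"
    by (simp add: up_seqs_def nonneg_seqs_def mat_domain_def incseq_def)
  ultimately show ?thesis by auto
qed

lemma is_least_constant_singleton_zero: "is_least_constant u v B {\<lambda>k. 0} 0"
  by (simp add: is_least_constant_def norm_ineq_def wnorm_def wnorm_nn_def mat_apply_def)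

section \<open>The four least constants\<close>

theorem theorem3p3:
  fixes u v :: "nat \<Rightarrow> real" and B :: "nat \<Rightarrow> nat \<Rightarrow> real"
  assumes "u \<in> nonneg_seqs" and "v \<in> nonneg_seqs"
  shows
    "is_least_constant u v B (mat_domain B) (wnorm_nn v (mat_apply_nn (mat_abs B) u))
   \<and> is_least_constant u v B (nonneg_seqs \<inter> mat_domain B)
       (max (wnorm_nn v (mat_apply_nn (mat_pos B) u)) (wnorm_nn v (mat_apply_nn (mat_neg B) u)))
   \<and> ((\<forall>n. pos_before_neg (B n) \<and> 0 \<le> ext_sum (B n)) \<longrightarrow>
       is_least_constant u v B (down_seqs \<inter> mat_domain B)
         (wnorm_nn v (mat_apply_nn (mat_pos B) (seq_down u))))
   \<and> ((\<forall>n. neg_before_pos (B n) \<and> 0 \<le> ext_sum (B n)) \<longrightarrow>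
       ((\<forall>n. \<bar>ext_sum (B n)\<bar> \<noteq> \<infinity>) \<longrightarrow>
          is_least_constant u v B (up_seqs \<inter> mat_domain B)
            (wnorm_nn v (mat_apply_nn (mat_pos B) (seq_up u)))) \<and>
       ((\<exists>n. \<bar>ext_sum (B n)\<bar> = \<infinity>) \<longrightarrow>
          up_seqs \<inter> mat_domain B = {\<lambda>k. 0} \<and>
          is_least_constant u v B (up_seqs \<inter> mat_domain B) 0))"
proof (intro conjI impI)
  show "is_least_constant u v B (mat_domain B) (wnorm_nn v (mat_apply_nn (mat_abs B) u))"
    using assms(1) by (rule is_least_constant_all)
  show "is_least_constant u v B (nonneg_seqs \<inter> mat_domain B)
      (max (wnorm_nn v (mat_apply_nn (mat_pos B) u)) (wnorm_nn v (mat_apply_nn (mat_neg B) u)))"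
    using assms(1) by (rule is_least_constant_nonneg)
  show "is_least_constant u v B (down_seqs \<inter> mat_domain B)
      (wnorm_nn v (mat_apply_nn (mat_pos B) (seq_down u)))"
    if "\<forall>n. pos_before_neg (B n) \<and> 0 \<le> ext_sum (B n)"
    using that assms(1) by (intro is_least_constant_down) auto
  assume rows: "\<forall>n. neg_before_pos (B n) \<and> 0 \<le> ext_sum (B n)"
  show "is_least_constant u v B (up_seqs \<inter> mat_domain B)
      (wnorm_nn v (mat_apply_nn (mat_pos B) (seq_up u)))"
    if "\<forall>n. \<bar>ext_sum (B n)\<bar> \<noteq> \<infinity>"
    using that rows assms(1) by (intro is_least_constant_up) auto
  assume "\<exists>n. \<bar>ext_sum (B n)\<bar> = \<infinity>"
  then show zero: "up_seqs \<inter> mat_domain B = {\<lambda>k. 0}"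
    using rows up_seqs_inter_mat_domain_infinite_row by meson
  show "is_least_constant u v B (up_seqs \<inter> mat_domain B) 0"
    unfolding zero by (rule is_least_constant_singleton_zero)
qed

end
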